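(* Let $d,k\in\mathbb{N}$ and let $\nu$ be a probability measure on $\mathbb{R}^d$ with compact support. Then the minimization problem $$\min_{A\in\{\mathbb{R}^d\}^k} F_\nu(A)\quad\text{subject to}\quad A\subset \mathrm{co}(\mathrm{supp}(\nu))$$ admits at least one minimizer, and its optimal value $F_\nu^\star$ satisfies $$F_\nu^\star\le\left(\int_{\mathbb{R}^d}\|x-\bar x\|_2^2\,d\nu(x)\right)^{1/2},$$ where $\bar x=\int_{\mathbb{R}^d}x\,d\nu(x)$ is the mean of $\nu$.
   Context: $\{\mathbb{R}^d\}^k$ denotes the set of unordered collections $A=\{a_\ell\}_{\ell\in[k]}$ of $k$ points of $\mathbb{R}^d$ (repetitions allowed), i.e. $(\mathbb{R}^d)^k$ modulo permutation of components; $[k]=\{1,\dots,k\}$. $\mathrm{co}(\cdot)$ denotes convex hull, $\mathrm{supp}(\nu)$ the support of $\nu$, and $d(x,S)=\inf_{y\in S}\|x-y\|_2$ the Euclidean distance from a point to a set. The objective is $$F_\nu(A)=\left(\int_{\mathbb{R}^d}d^2(x,\mathrm{co}(A))\,d\nu(x)\right)^{1/2}.$$ *)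

theory Defs
  imports "HOL-Probability.Probability" "HOL-Library.Multiset"
begin

definition measure_support :: "'a::topological_space measure \<Rightarrow> 'a set" where
  "measure_support \<nu> = {x. \<forall>U. open U \<longrightarrow> x \<in> U \<longrightarrow> emeasure \<nu> U > 0}"

text \<open>
  Unordered collections of \<open>k\<close> points, repetitions allowed, are multisets of size \<open>k\<close>.
  The collection is nonempty in every intended use (\<open>k \<ge> 1\<close>), so the convention
  \<open>infdist x {} = 0\<close> plays no role. For \<open>\<nu>\<close> a finite Borel measure of compact support the
  integrand below is integrable, so the Bochner integral is the intended one.
\<close>

definition hull_objective :: "'a::euclidean_space measure \<Rightarrow> 'a multiset \<Rightarrow> real" where
  "hull_objective \<nu> A =
     sqrt (\<integral>x. (infdist x (convex hull (set_mset A)))\<^sup>2 \<partial>\<nu>)"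

definition feasible_collections :: "'a::euclidean_space measure \<Rightarrow> nat \<Rightarrow> 'a multiset set" where
  "feasible_collections \<nu> k =
     {A. size A = k \<and> set_mset A \<subseteq> convex hull (measure_support \<nu>)}"

definition optimal_value :: "'a::euclidean_space measure \<Rightarrow> nat \<Rightarrow> real" where
  "optimal_value \<nu> k = (INF A\<in>feasible_collections \<nu> k. hull_objective \<nu> A)"

end

(* Index the collections by functions from nat, of which only the first k values matter; the
   feasible set becomes a compact product of copies of the hull K of the support. Moving each
   point by at most e moves the convex hull by at most e, so the distance to the hull is
   continuous in the points; as the support carries all the mass, dominated convergence makes
   the objective continuous, and a minimizer exists. The mean lies in K by separation, so the
   collection consisting of k copies of it is feasible and gives the bound. *)
theory Submission
  imports Defs
begin

text \<open>The right-hand side is a Minkowski sum of two convex sets, hence convex, so it is enough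
  that it contains each \<open>f i\<close>, which splits as
  \<open>g i + (f i - g i)\<close>.\<close>

lemma convex_hull_image_subset_enlargement:
  fixes f g :: "'i \<Rightarrow> 'a::euclidean_space"
  assumes "\<And>i. i \<in> I \<Longrightarrow> dist (f i) (g i) \<le> e"
  shows "convex hull (f ` I) \<subseteq> {y + z | y z. y \<in> convex hull (g ` I) \<and> z \<in> cball 0 e}"
proof (rule hull_minimal)
  show "f ` I \<subseteq> {y + z | y z. y \<in> convex hull (g ` I) \<and> z \<in> cball 0 e}"
  proof
    fix y assume "y \<in> f ` I"
    then obtain i where i: "i \<in> I" "y = f i" by blast
    have "y = g i + (f i - g i)" "g i \<in> convex hull (g ` I)" "f i - g i \<in> cball 0 e"
      using i assms[of i] by (auto simp: dist_norm norm_minus_commute hull_inc)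
    then show "y \<in> {y + z | y z. y \<in> convex hull (g ` I) \<and> z \<in> cball 0 e}" by blast
  qed
next
  \<comment> \<open>The sum is rewritten as a double union, the form in which
    \<open>convex_sums\<close> states convexity.\<close>
  have "{y + z | y z. y \<in> convex hull (g ` I) \<and> z \<in> cball 0 e}
      = (\<Union>y\<in>convex hull (g ` I). \<Union>z\<in>cball 0 e. {y + z})" by blast
  then show "convex {y + z | y z. y \<in> convex hull (g ` I) \<and> z \<in> cball 0 e}"
    by (simp only: convex_sums convex_convex_hull convex_cball)
qed

text \<open>Every point of the hull of \<open>f\<close> lies within \<open>e\<close> of the hull of
  \<open>g\<close>, so the triangle inequality applies; then take the infimum over that point.
  Exchanging \<open>f\<close> and \<open>g\<close> gives the two-sided estimate.\<close>

lemma infdist_convex_hull_image_le: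
  fixes f g :: "'i \<Rightarrow> 'a::euclidean_space"
  assumes "I \<noteq> {}" and "\<And>i. i \<in> I \<Longrightarrow> dist (f i) (g i) \<le> e"
  shows "infdist x (convex hull (g ` I)) \<le> infdist x (convex hull (f ` I)) + e"
proof -
  have ne: "convex hull (f ` I) \<noteq> {}" using assms(1) by simp
  have "infdist x (convex hull (g ` I)) - e \<le> dist x y" if "y \<in> convex hull (f ` I)" for y
  proof -
    have "y \<in> {y + z | y z. y \<in> convex hull (g ` I) \<and> z \<in> cball 0 e}"
      using convex_hull_image_subset_enlargement[OF assms(2)] that by (rule subsetD)
    then obtain u v where uv: "y = u + v" "u \<in> convex hull (g ` I)" "norm v \<le> e" by auto
    have "infdist x (convex hull (g ` I)) \<le> dist x u" by (rule infdist_le[OF uv(2)])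
    also have "\<dots> \<le> dist x y + dist y u" by (rule dist_triangle)
    also have "dist y u = norm v" using uv(1) by (simp add: dist_norm)
    finally show ?thesis using uv(3) by simp
  qed
  then have "infdist x (convex hull (g ` I)) - e \<le> infdist x (convex hull (f ` I))"
    unfolding infdist_notempty[OF ne] using ne by (intro cINF_greatest) auto
  then show ?thesis by simp
qed

lemma tendsto_infdist_convex_hull_image:
  fixes f :: "'b \<Rightarrow> 'i \<Rightarrow> 'a::euclidean_space"
  assumes "finite I" "I \<noteq> {}" and lim: "\<And>i. i \<in> I \<Longrightarrow> ((\<lambda>n. f n i) \<longlongrightarrow> g i) F"
  shows "((\<lambda>n. infdist x (convex hull (f n ` I))) \<longlongrightarrow> infdist x (convex hull (g ` I))) F"
proof -
  have "((\<lambda>n. \<Sum>i\<in>I. dist (f n i) (g i)) \<longlongrightarrow> (\<Sum>i\<in>I. 0)) F"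
    by (intro tendsto_sum) (use lim in \<open>simp only: tendsto_dist_iff[symmetric]\<close>)
  then have 0: "((\<lambda>n. \<Sum>i\<in>I. dist (f n i) (g i)) \<longlongrightarrow> 0) F" by simp
  \<comment> \<open>The sum bounds all the displacements at once, so it can serve as the radius
    \<open>e\<close>, and it tends to 0 because \<open>I\<close> is finite.\<close>
  have le: "dist (f n i) (g i) \<le> (\<Sum>i\<in>I. dist (f n i) (g i))"
    "dist (g i) (f n i) \<le> (\<Sum>i\<in>I. dist (f n i) (g i))" if "i \<in> I" for i n
    using member_le_sum[of i I "\<lambda>i. dist (f n i) (g i)"] that assms(1) by (auto simp: dist_commute)
  have "dist (infdist x (convex hull (f n ` I))) (infdist x (convex hull (g ` I)))
      \<le> (\<Sum>i\<in>I. dist (f n i) (g i))" for n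
    using infdist_convex_hull_image_le[of I "f n" g, OF assms(2) le(1), of x]
      infdist_convex_hull_image_le[of I g "f n", OF assms(2) le(2), of x]
    by (simp add: dist_real_def abs_le_iff)
  then show ?thesis
    by (subst tendsto_dist_iff) (rule tendsto_sandwich[OF _ _ tendsto_const 0], auto)
qed

text \<open>The complement of the support is the union of all open null sets. By Lindelof countably
  many of them have the same union, which is therefore null.\<close>

lemma AE_measure_support:
  fixes \<nu> :: "'a::second_countable_topology measure"
  assumes "sets \<nu> = sets borel"
  shows "AE x in \<nu>. x \<in> measure_support \<nu>"
proof -
  let ?N = "{U. open U \<and> emeasure \<nu> U = 0}"
  obtain N where N: "N \<subseteq> ?N" "countable N" "\<Union>N = \<Union>?N"
    by (rule Lindelof[of ?N]) auto
  have "\<Union>N \<in> null_sets \<nu>"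
    using null_sets_UN'[OF N(2), of "\<lambda>U. U" \<nu>] N(1) assms by (force intro: null_setsI)
  moreover have "x \<in> \<Union>N" if "x \<notin> measure_support \<nu>" for x
    unfolding N(3) using that by (auto simp: measure_support_def)
  ultimately show ?thesis
    by (intro AE_I'[of "\<Union>N"] subsetI) blast+
qed

lemma (in prob_space) expectation_in_closed_convex:
  fixes X :: "'a \<Rightarrow> 'b::euclidean_space"
  assumes K: "closed K" "convex K" and X: "integrable M X" "AE x in M. X x \<in> K"
  shows "expectation X \<in> K"
proof (rule ccontr)
  assume "expectation X \<notin> K"
  then obtain a b where ab: "a \<bullet> expectation X < b" "\<And>y. y \<in> K \<Longrightarrow> a \<bullet> y > b"
    using separating_hyperplane_closed_point[OF K(2,1)] by blast
  \<comment> \<open>Total mass 1 is used here: integrating the separating inequality over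
    \<open>X x\<close> in \<open>K\<close> contradicts the strict inequality at the mean.\<close>
  have "b = expectation (\<lambda>_. b)" by (simp add: prob_space)
  also have "\<dots> \<le> expectation (\<lambda>x. a \<bullet> X x)"
    using X ab(2) by (intro integral_mono_AE) (auto intro: less_imp_le elim!: eventually_mono)
  also have "\<dots> = a \<bullet> expectation X" using X(1) by simp
  finally show False using ab(1) by simp
qed

text \<open>Tychonoff's theorem, transferred to the type-class topology on functions.\<close>

lemma compact_PiE_UNIV:
  fixes K :: "'a::topological_space set"
  assumes "compact K"
  shows "compact (PiE (UNIV :: 'i set) (\<lambda>_. K))"
proof -
  have "compactin (product_topology (\<lambda>_. euclidean) UNIV) (PiE (UNIV :: 'i set) (\<lambda>_. K))"
    using assms by (simp add: compactin_PiE)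
  then show ?thesis by (simp add: euclidean_product_topology)
qed

text \<open>List the collection and pad with \<open>c\<close> beyond index \<open>k\<close>.
  Controlling the whole range places \<open>f\<close> in the compact product when \<open>c\<close>
  and the collection lie in \<open>K\<close>.\<close>

lemma mset_conv_image_mset_upto:
  assumes "size A = k"
  obtains f :: "nat \<Rightarrow> 'a" where "A = image_mset f (mset_set {..<k})" "range f \<subseteq> insert c (set_mset A)"
proof -
  obtain xs where xs: "mset xs = A" using ex_mset by blast
  then have len: "length xs = k" using assms size_mset by metis
  define f where "f i = (if i < k then xs ! i else c)" for i
  have "A = mset (map f [0..<k])"
    unfolding xs[symmetric] len[symmetric]
    by (rule arg_cong[where f=mset], rule nth_equalityI) (auto simp: f_def len)
  then have "A = image_mset f (mset_set {..<k})"
    by (simp add: atLeast0LessThan)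
  moreover have "range f \<subseteq> insert c (set_mset A)"
    using xs len by (auto simp: f_def)
  ultimately show ?thesis by (rule that)
qed

lemma continuous_on_hull_objective:
  fixes \<nu> :: "'a::euclidean_space measure" and K :: "'a set" and k :: nat
  assumes "finite_measure \<nu>" "sets \<nu> = sets borel" "bounded K" "AE x in \<nu>. x \<in> K"
    and "k \<ge> 1"
  shows "continuous_on (PiE UNIV (\<lambda>_. K)) (\<lambda>f. hull_objective \<nu> (image_mset f (mset_set {..<k})))"
\<comment> \<open>Sequences suffice since the index type \<open>nat\<close> is countable, and
  dominated convergence needs sequences.\<close>
proof (rule continuous_on_sequentiallyI)
  interpret finite_measure \<nu> by fact
  fix u :: "nat \<Rightarrow> nat \<Rightarrow> 'a" and a
  assume u: "\<forall>n. u n \<in> PiE UNIV (\<lambda>_. K)" and a: "a \<in> PiE UNIV (\<lambda>_. K)" and lim: "u \<longlonglongrightarrow> a"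
  have limi: "(\<lambda>n. u n i) \<longlonglongrightarrow> a i" for i
    using continuous_on_tendsto_compose[OF continuous_on_product_coordinates[of i] lim] by simp
  have meas [measurable]: "(\<lambda>x. (infdist x S)\<^sup>2) \<in> borel_measurable \<nu>" for S :: "'a set"
    unfolding measurable_cong_sets[OF assms(2) refl]
    by (intro borel_measurable_continuous_onI continuous_intros)
  have bound: "AE x in \<nu>. norm ((infdist x (convex hull (u n ` {..<k})))\<^sup>2) \<le> (diameter K)\<^sup>2" for n
    using assms(4)
  proof eventually_elim
    case (elim x)
    \<comment> \<open>As \<open>k \<ge> 1\<close>, index 0 is among the points; both it and almost
      every \<open>x\<close> lie in \<open>K\<close>, so the squared diameter dominates.\<close>
    have "u n 0 \<in> convex hull (u n ` {..<k})" using assms(5) by (intro hull_inc) auto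
    then have "infdist x (convex hull (u n ` {..<k})) \<le> dist x (u n 0)" by (rule infdist_le)
    also have "\<dots> \<le> diameter K"
      using u elim assms(3) by (intro diameter_bounded_bound) (auto simp: PiE_iff)
    finally show ?case by (simp add: infdist_nonneg power_mono)
  qed
  have "(\<lambda>n. \<integral>x. (infdist x (convex hull (u n ` {..<k})))\<^sup>2 \<partial>\<nu>)
      \<longlonglongrightarrow> (\<integral>x. (infdist x (convex hull (a ` {..<k})))\<^sup>2 \<partial>\<nu>)"
  proof (rule integral_dominated_convergence[OF meas meas _ _ bound])
    show "AE x in \<nu>. (\<lambda>n. (infdist x (convex hull (u n ` {..<k})))\<^sup>2)
        \<longlonglongrightarrow> (infdist x (convex hull (a ` {..<k})))\<^sup>2"
      using assms(5) limi
      by (intro AE_I2 tendsto_power tendsto_infdist_convex_hull_image) (auto simp: lessThan_empty_iff)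
  qed simp
  then show "(\<lambda>n. hull_objective \<nu> (image_mset (u n) (mset_set {..<k})))
      \<longlonglongrightarrow> hull_objective \<nu> (image_mset a (mset_set {..<k}))"
    unfolding hull_objective_def by (simp add: tendsto_real_sqrt)
qed

theorem theorem1p1:
  fixes \<nu> :: "(real ^ 'd) measure" and k :: nat
  assumes "k \<ge> 1"
    and "prob_space \<nu>"
    and "sets \<nu> = sets borel"
    and "compact (measure_support \<nu>)"
  shows "(\<exists>A. is_arg_min (hull_objective \<nu>) (\<lambda>A. A \<in> feasible_collections \<nu> k) A) \<and>
    optimal_value \<nu> k \<le> sqrt (\<integral>x. (norm (x - (\<integral>y. y \<partial>\<nu>)))\<^sup>2 \<partial>\<nu>)"
proof -
  interpret prob_space \<nu> by fact
  define K where "K = convex hull (measure_support \<nu>)"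
  define F where "F f = hull_objective \<nu> (image_mset f (mset_set {..<k}))" for f
  define m where "m = (\<integral>y. y \<partial>\<nu>)"
  have K: "compact K" "convex K"
    unfolding K_def using assms(4) by (auto intro: compact_convex_hull)
  have AEK: "AE x in \<nu>. x \<in> K"
    using AE_measure_support[OF assms(3)] by eventually_elim (simp add: K_def hull_inc)
  obtain B where B: "\<And>x. x \<in> K \<Longrightarrow> norm x \<le> B"
    using compact_imp_bounded[OF K(1)] by (auto simp: bounded_iff)
  have "(\<lambda>y. y) \<in> borel_measurable \<nu>"
    unfolding measurable_cong_sets[OF assms(3) refl] by simp
  moreover have "AE x in \<nu>. norm x \<le> B"
    using AEK by eventually_elim (rule B)
  ultimately have "integrable \<nu> (\<lambda>y. y)"
    by (rule integrable_const_bound[rotated])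
  then have m: "m \<in> K"
    unfolding m_def by (rule expectation_in_closed_convex[OF compact_imp_closed[OF K(1)] K(2) _ AEK])
  have "\<exists>f\<in>PiE UNIV (\<lambda>_. K). \<forall>g\<in>PiE UNIV (\<lambda>_. K). F f \<le> F g"
  proof (rule continuous_attains_inf)
    show "compact (PiE UNIV (\<lambda>_::nat. K))" by (rule compact_PiE_UNIV[OF K(1)])
    show "PiE UNIV (\<lambda>_::nat. K) \<noteq> {}" using m by (auto simp: PiE_eq_empty_iff)
    show "continuous_on (PiE UNIV (\<lambda>_. K)) F"
      unfolding F_def
      by (rule continuous_on_hull_objective[OF finite_measure_axioms assms(3)
            compact_imp_bounded[OF K(1)] AEK assms(1)])
  qed
  then obtain f where f: "range f \<subseteq> K" and min: "\<And>g. range g \<subseteq> K \<Longrightarrow> F f \<le> F g"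
    by (auto simp: PiE_iff image_subset_iff)
  let ?A = "image_mset f (mset_set {..<k})"
  have "?A \<in> feasible_collections \<nu> k"
    using f by (auto simp: feasible_collections_def K_def)
  moreover have "hull_objective \<nu> ?A \<le> hull_objective \<nu> A" if A: "A \<in> feasible_collections \<nu> k" for A
  proof -
    have "size A = k" and AK: "set_mset A \<subseteq> K"
      using A by (auto simp: feasible_collections_def K_def)
    \<comment> \<open>The padding value is \<open>m\<close>, already known to lie in
      \<open>K\<close>.\<close>
    then obtain g where g: "A = image_mset g (mset_set {..<k})" "range g \<subseteq> insert m (set_mset A)"
      using mset_conv_image_mset_upto by metis
    then have "range g \<subseteq> K" using AK m by blast
    from min[OF this] show ?thesis by (simp add: F_def g(1))
  qed
  ultimately have "is_arg_min (hull_objective \<nu>) (\<lambda>A. A \<in> feasible_collections \<nu> k) ?A"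
    by (auto simp: is_arg_min_linorder)
  moreover have "optimal_value \<nu> k \<le> sqrt (\<integral>x. (norm (x - m))\<^sup>2 \<partial>\<nu>)"
  proof -
    have "optimal_value \<nu> k \<le> hull_objective \<nu> (replicate_mset k m)"
      unfolding optimal_value_def
    proof (rule cINF_lower)
      show "bdd_below (hull_objective \<nu> ` feasible_collections \<nu> k)"
        by (rule bdd_belowI2[where m=0]) (simp add: hull_objective_def)
      show "replicate_mset k m \<in> feasible_collections \<nu> k"
        using m by (auto simp: feasible_collections_def K_def split: if_splits)
    qed
    \<comment> \<open>Since \<open>k \<ge> 1\<close>, the hull of the copies is the singleton of
      \<open>m\<close>, and the distance to it is \<open>dist x m\<close>.\<close>
    also have "\<dots> = sqrt (\<integral>x. (norm (x - m))\<^sup>2 \<partial>\<nu>)"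
      using assms(1) by (simp add: hull_objective_def dist_norm)
    finally show ?thesis .
  qed
  ultimately show ?thesis unfolding m_def by blast
qed

end
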